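(* There exists an absolute constant $C>0$ such that the following holds. Let $1\le r\le m\le n$ and $n_e\ge1$ be integers and $k>0$. Let $Y\in\mathbb{R}^{m\times n}$ be the rank-$r$ rating matrix of the honest users, with column space $\mathcal{N}$, and let $n_e$ dummy users be injected by a Targeted Attack: the $i$-th dummy user's rating column is $e_i=e_i^{gnd}+s_i\in\mathbb{R}^m$, with $e_i^{gnd}\in\mathcal{N}$ and $s_i$ having at most $s_{max}$ nonzero entries ($i=1,\dots,n_e$). Put $E^{gnd}=[e_1^{gnd},\dots,e_{n_e}^{gnd}]$ and $\widehat{E}=[e_1,\dots,e_{n_e}]$, and assume all entries of the ground truth $[\,Y\,|\,E^{gnd}\,]$ and of the corrupted matrix $[\,Y\,|\,\widehat{E}\,]$ lie in $[-k,k]$. Let $\Omega\subseteq\{1,\dots,m\}\times\{1,\dots,n+n_e\}$ be a sampling set of given nonzero cardinality $|\Omega|$ chosen uniformly at random, and let $[\,Y^*\,|\,E^*\,]=U^*V^{*T}$, where $(U^*,V^* )$ is a global optimal solution of $$\min_{U\in\mathbb{R}^{m\times r},\,V\in\mathbb{R}^{(n+n_e)\times r}}\ \frac12\left\|P_\Omega\big(UV^T-[\,Y\,|\,\widehat{E}\,]\big)\right\|_F^2\quad\text{subject to}\quad\left|[UV^T]_{i,j}\right|\le k\ \text{ for all }i,j.$$ Then, with probability at least $1-2\exp(-(n+n_e))$, $$\mathrm{RMSE}\ \le\ 4k\sqrt{\frac{s_{max}n_e}{|\Omega|}}+Ck\left(\frac{(n+n_e)\,r\log(n+n_e)}{|\Omega|}\right)^{\frac14},$$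 where $\mathrm{RMSE}=\frac{1}{\sqrt{m(n+n_e)}}\left\|[\,Y^*-Y\,|\,E^*-E^{gnd}\,]\right\|_F$.
   Context: $\|\cdot\|_F$ is the Frobenius norm. The sampling operator $P_\Omega$ is defined by $[P_\Omega(X)]_{i,j}=X_{i,j}$ if $(i,j)\in\Omega$ and $0$ otherwise. The sampling of $\Omega$ is uniform without replacement, i.e. $\Omega$ is uniformly distributed over all subsets of the given cardinality; the matrices $Y$ and $\widehat{E}$ are fixed beforehand. $[A\,|\,B]$ denotes column-wise concatenation. The number $s_{max}$ is the maximal number of targeted items of a dummy user. *)

theory Defs
  imports
    "HOL-Probability.Probability_Mass_Function"
    "Jordan_Normal_Form.DL_Rank"
begin

unbundle no vec_syntax

text \<open>Rows and columns are indexed from 0, so an \<open>m\<close> by \<open>q\<close> matrix has its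
  entries at the positions in \<open>{..<m} \<times> {..<q}\<close>.\<close>

definition append_cols :: "'a mat \<Rightarrow> 'a mat \<Rightarrow> 'a mat" where
  "append_cols A B = mat (dim_row A) (dim_col A + dim_col B)
     (\<lambda>(i, j). if j < dim_col A then A $$ (i, j) else B $$ (i, j - dim_col A))"

definition frob_norm :: "real mat \<Rightarrow> real" where
  "frob_norm A = sqrt (\<Sum>i<dim_row A. \<Sum>j<dim_col A. (A $$ (i, j))\<^sup>2)"

definition sampling_op :: "(nat \<times> nat) set \<Rightarrow> real mat \<Rightarrow> real mat" where
  "sampling_op \<Omega> X = mat (dim_row X) (dim_col X)
     (\<lambda>(i, j). if (i, j) \<in> \<Omega> then X $$ (i, j) else 0)"

definition sampling_sets :: "nat \<Rightarrow> nat \<Rightarrow> nat \<Rightarrow> (nat \<times> nat) set set" where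
  "sampling_sets m q N = {\<Omega>. \<Omega> \<subseteq> {..<m} \<times> {..<q} \<and> card \<Omega> = N}"

definition entries_bounded :: "real \<Rightarrow> real mat \<Rightarrow> bool" where
  "entries_bounded k X \<longleftrightarrow> (\<forall>i<dim_row X. \<forall>j<dim_col X. \<bar>X $$ (i, j)\<bar> \<le> k)"

definition mf_objective :: "(nat \<times> nat) set \<Rightarrow> real mat \<Rightarrow> real mat \<times> real mat \<Rightarrow> real" where
  "mf_objective \<Omega> M = (\<lambda>(U, V). 1 / 2 * (frob_norm (sampling_op \<Omega> (U * V\<^sup>T - M)))\<^sup>2)"

definition mf_feasible :: "nat \<Rightarrow> nat \<Rightarrow> nat \<Rightarrow> real \<Rightarrow> real mat \<times> real mat \<Rightarrow> bool" where
  "mf_feasible m q r k = (\<lambda>(U, V). U \<in> carrier_mat m r \<and> V \<in> carrier_mat q r \<and>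
     entries_bounded k (U * V\<^sup>T))"

definition mf_solution ::
  "nat \<Rightarrow> nat \<Rightarrow> nat \<Rightarrow> real \<Rightarrow> (nat \<times> nat) set \<Rightarrow> real mat \<Rightarrow> real mat \<Rightarrow> real mat \<Rightarrow> bool" where
  "mf_solution m q r k \<Omega> M U V \<longleftrightarrow>
     is_arg_min (mf_objective \<Omega> M) (mf_feasible m q r k) (U, V)"

definition rmse :: "real mat \<Rightarrow> real mat \<Rightarrow> real mat \<Rightarrow> real mat \<Rightarrow> real" where
  "rmse Ystar Estar Y Egnd =
     1 / sqrt (real (dim_row Y * (dim_col Y + dim_col Egnd))) *
     frob_norm (append_cols (Ystar - Y) (Estar - Egnd))"

definition targeted_attack ::
  "nat \<Rightarrow> real mat \<Rightarrow> nat \<Rightarrow> nat \<Rightarrow> (nat \<Rightarrow> real Matrix.vec) \<Rightarrow> (nat \<Rightarrow> real Matrix.vec) \<Rightarrow> bool" where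
  "targeted_attack m Y ne smax egnd s \<longleftrightarrow>
     (\<forall>i<ne. egnd i \<in> vec_space.col_space m Y \<and> s i \<in> carrier_vec m \<and>
       card {l. l < m \<and> s i $ l \<noteq> 0} \<le> smax)"

end

theory Submission
  imports Defs
begin

text \<open>
  By optimality and feasibility of the ground truth, the sampled error of the solution is at
  most twice the norm of the corruption, i.e. at most \<open>4 k \<surd>(s_max n_e)\<close>. It remains to compare
  sampled and full mean square errors uniformly over all matrices of rank at most \<open>r\<close> with
  entries in \<open>[-k, k]\<close>. For a fixed matrix this is a Chernoff bound, where sampling without
  replacement is dominated by sampling with replacement through a Maclaurin-type inequality for
  elementary symmetric functions. For the union bound, each such matrix factors as \<open>C W\<^sup>T\<close> with
  entries of \<open>C\<close> in \<open>[-k, k]\<close> and of \<open>W\<close> in \<open>[-1, 1]\<close>, so rounding both factors to a grid of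
  spacing of order \<open>1/(r q)\<close>, with \<open>q = n + n_e\<close>, gives a net of entrywise accuracy \<open>k/q\<close> and
  cardinality \<open>exp (O(q r log q))\<close>.
\<close>

section \<open>Comparing sampling without and with replacement\<close>

text \<open>The right-hand side is the tangent of the left-hand side at \<open>u = 0\<close>.
  Multiplying the tangent for \<open>p\<close> by the nonnegative factor \<open>1 - u / a\<close>
  gives the tangent for \<open>Suc p\<close> minus \<open>u\<^sup>2 / a * (1 - p / a)\<close>, and
  this correction is nonnegative while \<open>p \<le> a\<close>.\<close>

lemma one_plus_mult_power_le:
  fixes u a :: real
  assumes "real p \<le> a" "-1 \<le> u" "u \<le> a"
  shows "(1 + u) * (1 - u / a) ^ p \<le> 1 + u - p * u / a"
  using assms(1)
proof (induction p)
  case (Suc p)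
  then have a: "a > 0" by simp
  have "(1 + u) * (1 - u / a) ^ Suc p = ((1 + u) * (1 - u / a) ^ p) * (1 - u / a)"
    by simp
  also have "\<dots> \<le> (1 + u - p * u / a) * (1 - u / a)"
    using Suc a assms by (intro mult_right_mono) auto
  also have "\<dots> = 1 + u - Suc p * u / a - u\<^sup>2 / a * (1 - p / a)"
    using a by (simp add: field_simps power2_eq_square)
  also have "\<dots> \<le> 1 + u - Suc p * u / a"
    using Suc a by (simp add: mult_nonneg_nonneg)
  finally show ?case .
qed simp

text \<open>Again a tangent bound, now at \<open>y = \<mu>\<close>; the substitutions
  \<open>y = \<mu> * (1 + u)\<close> and \<open>a = D - 1\<close> reduce it to the previous
  lemma.\<close>

lemma mult_power_le_tangent:
  fixes y \<mu> :: real and D :: nat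
  assumes "p < D" "0 \<le> y" "y \<le> D * \<mu>"
  shows "y * ((D * \<mu> - y) / (D - 1)) ^ p
    \<le> \<mu> ^ Suc p + \<mu> ^ p * (1 - p / (D - 1)) * (y - \<mu>)"
proof (cases "\<mu> = 0")
  case True
  then show ?thesis using assms by simp
next
  case False
  have \<mu>: "\<mu> > 0" using assms False mult_pos_neg[of "real D" \<mu>] by fastforce
  show ?thesis
  proof (cases "D = 1")
    case True
    \<comment> \<open>Here \<open>p = 0\<close>, and division by zero yields 0, so both sides equal
      \<open>y\<close>.\<close>
    then show ?thesis using assms by simp
  next
    case False
    then have D: "real D - 1 > 0" using assms by simp
    define u where "u = y / \<mu> - 1"
    have y: "y = \<mu> * (1 + u)" using \<mu> by (simp add: u_def)
    have "(1 + u) * (1 - u / (D - 1)) ^ p \<le> 1 + u - p * u / (D - 1)"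
      using assms \<mu> D by (intro one_plus_mult_power_le) (auto simp: u_def field_simps)
    then have "\<mu> ^ Suc p * ((1 + u) * (1 - u / (D - 1)) ^ p) \<le> \<mu> ^ Suc p * (1 + u - p * u / (D - 1))"
      using \<mu> by (intro mult_left_mono) auto
    moreover have z: "(D * \<mu> - y) / (D - 1) = \<mu> * (1 - u / (D - 1))"
      using D assms(1) by (simp add: y field_simps)
    ultimately show ?thesis
      unfolding z power_mult_distrib by (simp add: y algebra_simps)
  qed
qed

text \<open>
  The induction conditions on the first element drawn; bounding \<open>y \<mapsto> y ((D \<mu> - y)/(D - 1))\<^sup>N\<close> by its
  tangent at the mean \<open>\<mu>\<close> makes the linear term cancel in the sum.
\<close>

lemma sum_n_subsets_prod_le:
  fixes g :: "'a \<Rightarrow> real"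
  assumes "finite S" "N \<le> card S" "\<And>x. x \<in> S \<Longrightarrow> 0 \<le> g x"
  shows "(\<Sum>A | A \<subseteq> S \<and> card A = N. prod g A)
    \<le> (card S choose N) * (sum g S / card S) ^ N"
  using assms
proof (induction N arbitrary: S)
  case 0
  have "{A. A \<subseteq> S \<and> card A = 0} = {{}}" 
    using 0 by (auto dest: finite_subset)
  then show ?case by simp
next
  case (Suc N S)
  define D where "D = card S"
  define \<mu> where "\<mu> = sum g S / D"
  let ?F = "\<lambda>S N. {A. A \<subseteq> S \<and> card A = N}"
  have fin: "finite (?F T M)" if "finite T" for T :: "'a set" and M
    using that by auto
  have D: "N < D" "D > 0" using Suc by (auto simp: D_def)
  have sumg: "sum g S = D * \<mu>" using D by (simp add: \<mu>_def)
  have split: "(\<Sum>A\<in>?F S (Suc N). if x \<in> A then prod g A else 0)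
     = g x * (\<Sum>A\<in>?F (S - {x}) N. prod g A)" if x: "x \<in> S" for x
  proof -
    have "(\<Sum>A\<in>?F S (Suc N). if x \<in> A then prod g A else 0)
      = (\<Sum>A\<in>{A \<in> ?F S (Suc N). x \<in> A}. prod g A)"
      using fin[OF Suc.prems(1)] by (subst sum.inter_filter) auto
    also have "\<dots> = (\<Sum>A\<in>?F (S - {x}) N. prod g (insert x A))"
    proof (rule sum.reindex_bij_witness[where i = "insert x" and j = "\<lambda>A. A - {x}"])
      fix A assume "A \<in> ?F (S - {x}) N"
      then have "finite A" "x \<notin> A" "A \<subseteq> S" "card A = N"
        using Suc.prems(1) by (auto intro: finite_subset)
      then show "insert x A \<in> {A \<in> ?F S (Suc N). x \<in> A}"
        using x by simp
    qed (auto simp: insert_absorb)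
    also have "\<dots> = (\<Sum>A\<in>?F (S - {x}) N. g x * prod g A)"
      using Suc.prems(1) by (intro sum.cong refl prod.insert) (auto intro: finite_subset)
    finally show ?thesis by (simp add: sum_distrib_left)
  qed
  \<comment> \<open>Double counting of the pairs \<open>x \<in> A\<close>: each \<open>A\<close>
    occurs once for each of its \<open>Suc N\<close> elements.\<close>
  have "real (Suc N) * (\<Sum>A\<in>?F S (Suc N). prod g A)
    = (\<Sum>A\<in>?F S (Suc N). \<Sum>x\<in>S. if x \<in> A then prod g A else 0)"
    unfolding sum_distrib_left
  proof (intro sum.cong refl)
    fix A assume A: "A \<in> ?F S (Suc N)"
    have "(\<Sum>x\<in>S. if x \<in> A then prod g A else 0) = (\<Sum>x\<in>{x\<in>S. x \<in> A}. prod g A)"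
      using Suc.prems(1) by (subst sum.inter_filter) auto
    also have "{x\<in>S. x \<in> A} = A" using A by auto
    finally show "real (Suc N) * prod g A = (\<Sum>x\<in>S. if x \<in> A then prod g A else 0)"
      using A by simp
  qed
  also have "\<dots> = (\<Sum>x\<in>S. g x * (\<Sum>A\<in>?F (S - {x}) N. prod g A))"
    by (subst sum.swap) (intro sum.cong refl split)
  \<comment> \<open>Induction hypothesis for \<open>S - {x}\<close>, which has \<open>D - 1\<close>
    elements and total weight \<open>D * \<mu> - g x\<close>.\<close>
  also have "\<dots> \<le> (\<Sum>x\<in>S. g x * (((D - 1) choose N) * ((D * \<mu> - g x) / (D - 1)) ^ N))"
  proof (intro sum_mono mult_left_mono)
    fix x assume x: "x \<in> S"
    then show "(\<Sum>A\<in>?F (S - {x}) N. prod g A) \<le> ((D - 1) choose N) * ((D * \<mu> - g x) / (D - 1)) ^ N"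
      using Suc.IH[of "S - {x}"] Suc.prems D
      by (simp add: D_def[symmetric] sum_diff1 sumg of_nat_diff card_Diff_singleton)
  qed (use Suc in auto)
  also have "\<dots> = ((D - 1) choose N) * (\<Sum>x\<in>S. g x * ((D * \<mu> - g x) / (D - 1)) ^ N)"
    by (simp add: sum_distrib_left mult_ac)
  also have "\<dots> \<le> ((D - 1) choose N) * (\<Sum>x\<in>S. \<mu> ^ Suc N + \<mu> ^ N * (1 - N / (D - 1)) * (g x - \<mu>))"
  proof (intro sum_mono mult_left_mono)
    fix x assume x: "x \<in> S"
    have "g x \<le> sum g S" using x Suc.prems by (intro member_le_sum) auto
    then show "g x * ((D * \<mu> - g x) / (D - 1)) ^ N
      \<le> \<mu> ^ Suc N + \<mu> ^ N * (1 - N / (D - 1)) * (g x - \<mu>)"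
      using x D Suc.prems sumg by (intro mult_power_le_tangent) auto
  qed auto
  also have "(\<Sum>x\<in>S. \<mu> ^ Suc N + \<mu> ^ N * (1 - N / (D - 1)) * (g x - \<mu>)) = D * \<mu> ^ Suc N"
    by (simp add: sum.distrib sum_distrib_left[symmetric] sum_subtractf sumg D_def[symmetric])
  also have "real ((D - 1) choose N) * (D * \<mu> ^ Suc N) = Suc N * ((D choose Suc N) * \<mu> ^ Suc N)"
  proof -
    have "Suc N * (D choose Suc N) = D * ((D - 1) choose N)"
      using Suc_times_binomial_eq[of "D - 1" N] D by (simp add: mult.commute)
    then have "real (Suc N) * (D choose Suc N) = real D * ((D - 1) choose N)"
      by (metis of_nat_mult)
    then show ?thesis by (simp add: mult_ac)
  qed
  finally have "real (Suc N) * (\<Sum>A\<in>?F S (Suc N). prod g A)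
      \<le> real (Suc N) * ((D choose Suc N) * \<mu> ^ Suc N)" by simp
  then show ?case
    unfolding \<mu>_def D_def by (subst (asm) mult_le_cancel_left_pos) auto
qed

section \<open>A lower-tail Chernoff bound for a random subset\<close>

text \<open>The difference of the two sides vanishes at 0 and has derivative
  \<open>- 1 + y + exp (- y)\<close>, which is nonnegative.\<close>

lemma exp_minus_le_quadratic:
  fixes x :: real
  assumes "0 \<le> x"
  shows "exp (- x) \<le> 1 - x + x\<^sup>2 / 2"
proof -
  let ?f = "\<lambda>x::real. 1 - x + x\<^sup>2 / 2 - exp (- x)"
  have "?f 0 \<le> ?f x"
  proof (rule DERIV_nonneg_imp_nondecreasing[OF assms])
    fix y :: real assume "0 \<le> y" 
    have "(?f has_real_derivative (- 1 + y + exp (- y))) (at y)"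
      by (auto intro!: derivative_eq_intros)
    moreover have "- 1 + y + exp (- y) \<ge> 0"
      using exp_ge_add_one_self[of "- y"] by linarith
    ultimately show "\<exists>z. (?f has_real_derivative z) (at y) \<and> 0 \<le> z" by blast
  qed
  then show ?thesis by simp
qed

text \<open>Exponential Markov inequality, with the subset average of
  \<open>exp (- (c * sum f A))\<close> bounded by the \<open>N\<close>-th power of the mean of
  \<open>exp (- (c * f x))\<close>. The lower tail suffices, because only a sampled error far below
  the full one is harmful.\<close>

lemma prob_sample_sum_le:
  fixes f :: "'a \<Rightarrow> real"
  assumes S: "finite S" and N: "1 \<le> N" "N \<le> card S"
    and f: "\<And>x. x \<in> S \<Longrightarrow> 0 \<le> f x" "\<And>x. x \<in> S \<Longrightarrow> f x \<le> B"
    and B: "0 < B" and t: "0 \<le> t"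
  shows "measure_pmf.prob (pmf_of_set {A. A \<subseteq> S \<and> card A = N})
      {A. sum f A \<le> N * (sum f S / card S - t)} \<le> exp (- (N * t\<^sup>2 / (2 * B\<^sup>2)))"
proof -
  let ?F = "{A. A \<subseteq> S \<and> card A = N}"
  define D where "D = card S"
  define \<mu> where "\<mu> = sum f S / D"
  \<comment> \<open>This choice minimises the exponent
    \<open>c\<^sup>2 * B\<^sup>2 / 2 - c * t\<close> reached below.\<close>
  define c where "c = t / B\<^sup>2"
  let ?G = "?F \<inter> {A. sum f A \<le> N * (\<mu> - t)}"
  have c: "c \<ge> 0" using B t by (simp add: c_def)
  have D: "D > 0" using N by (simp add: D_def)
  have finF: "finite ?F" using S by auto
  have cardF: "card ?F = D choose N" using S by (simp add: n_subsets D_def)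
  have pos: "D choose N > 0" using N by (simp add: D_def zero_less_binomial)
  have ne: "?F \<noteq> {}" using pos cardF by (metis card.empty less_irrefl)
  have "(\<Sum>x\<in>S. exp (- (c * f x))) \<le> (\<Sum>x\<in>S. 1 - c * f x + c\<^sup>2 * B\<^sup>2 / 2)"
  proof (rule sum_mono)
    fix x assume x: "x \<in> S"
    have "exp (- (c * f x)) \<le> 1 - c * f x + (c * f x)\<^sup>2 / 2"
      using x c f by (intro exp_minus_le_quadratic) auto
    also have "(c * f x)\<^sup>2 \<le> (c * B)\<^sup>2"
      using x c f by (intro power_mono mult_left_mono) auto
    finally show "exp (- (c * f x)) \<le> 1 - c * f x + c\<^sup>2 * B\<^sup>2 / 2"
      by (simp add: power_mult_distrib)
  qed
  also have "\<dots> = D * (1 + (c\<^sup>2 * B\<^sup>2 / 2 - c * \<mu>))"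
    using D by (simp add: sum.distrib sum_subtractf sum_distrib_left[symmetric] \<mu>_def D_def algebra_simps)
  also have "\<dots> \<le> D * exp (c\<^sup>2 * B\<^sup>2 / 2 - c * \<mu>)"
    by (intro mult_left_mono exp_ge_add_one_self) auto
  finally have mean: "(\<Sum>x\<in>S. exp (- (c * f x))) / D \<le> exp (c\<^sup>2 * B\<^sup>2 / 2 - c * \<mu>)"
    using D by (simp add: field_simps)
  \<comment> \<open>Markov's inequality, written with cardinalities: every member of
    \<open>?G\<close> has exponential weight at least
    \<open>exp (- (c * (N * (\<mu> - t))))\<close>.\<close>
  have "card ?G * exp (- (c * (N * (\<mu> - t)))) = (\<Sum>A\<in>?G. exp (- (c * (N * (\<mu> - t)))))"
    by simp
  also have "\<dots> \<le> (\<Sum>A\<in>?G. exp (- (c * sum f A)))"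
    using c by (intro sum_mono) (auto intro: mult_left_mono)
  also have "\<dots> \<le> (\<Sum>A\<in>?F. exp (- (c * sum f A)))"
    using finF by (intro sum_mono2) auto
  also have "\<dots> = (\<Sum>A\<in>?F. \<Prod>x\<in>A. exp (- (c * f x)))"
    using S by (intro sum.cong refl)
      (auto simp: exp_sum[symmetric] sum_distrib_left sum_negf dest: finite_subset)
  also have "\<dots> \<le> (D choose N) * ((\<Sum>x\<in>S. exp (- (c * f x))) / D) ^ N"
    unfolding D_def using S N by (intro sum_n_subsets_prod_le) auto
  also have "\<dots> \<le> (D choose N) * exp (c\<^sup>2 * B\<^sup>2 / 2 - c * \<mu>) ^ N"
    by (intro mult_left_mono power_mono mean) (auto intro!: divide_nonneg_nonneg sum_nonneg)
  finally have "card ?G \<le> (D choose N) * exp (c\<^sup>2 * B\<^sup>2 / 2 - c * \<mu>) ^ N * exp (c * (N * (\<mu> - t)))"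
    unfolding exp_minus by (simp add: divide_inverse[symmetric] pos_divide_le_eq)
  also have "\<dots> = (D choose N) * exp (N * (c\<^sup>2 * B\<^sup>2 / 2 - c * t))"
    by (simp add: exp_of_nat_mult[symmetric] exp_add[symmetric] algebra_simps)
  also have "c\<^sup>2 * B\<^sup>2 / 2 - c * t = - (t\<^sup>2 / (2 * B\<^sup>2))"
    using B by (simp add: c_def field_simps power2_eq_square)
  finally have "card ?G / (D choose N) \<le> exp (- (N * t\<^sup>2 / (2 * B\<^sup>2)))"
    using pos by (simp add: field_simps)
  then show ?thesis
    using finF ne by (simp add: measure_pmf_of_set cardF \<mu>_def D_def)
qed

section \<open>A finite net for bounded low rank matrices\<close>

text \<open>
  The columns of \<open>C\<close> are obtained from an Auerbach basis: among the rows of \<open>V\<close> choose \<open>r\<close> ones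
  maximising the absolute determinant, so that by Cramer's rule every row of \<open>V\<close> is a combination
  of them with coefficients in \<open>[-1, 1]\<close>. Adding small multiples of the unit vectors to the
  candidates ensures a nonzero maximum even if \<open>V\<close> is rank deficient.
\<close>

lemma bounded_factorization:
  fixes u v :: "nat \<Rightarrow> nat \<Rightarrow> real"
  assumes k: "0 < k"
    and uv: "\<And>i j. i < m \<Longrightarrow> j < q \<Longrightarrow> \<bar>\<Sum>l<r. u i l * v j l\<bar> \<le> k"
  obtains c w :: "nat \<Rightarrow> nat \<Rightarrow> real"
  where "\<And>i l. i < m \<Longrightarrow> l < r \<Longrightarrow> \<bar>c i l\<bar> \<le> k"
    and "\<And>j l. j < q \<Longrightarrow> l < r \<Longrightarrow> \<bar>w j l\<bar> \<le> 1"
    and "\<And>i j. i < m \<Longrightarrow> j < q \<Longrightarrow> (\<Sum>l<r. u i l * v j l) = (\<Sum>l<r. c i l * w j l)"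
proof -
  \<comment> \<open>\<open>\<eta>\<close> is so small that
    \<open>\<bar>\<eta> * u i l\<bar> \<le> k\<close>. Thus the scaled unit vectors, like the rows
    of \<open>v\<close>, have products at most \<open>k\<close> in absolute value with the rows of
    \<open>u\<close>; this becomes the bound on the entries of the left factor.\<close>
  define \<eta> where "\<eta> = k / (1 + (\<Sum>i<m. \<Sum>l<r. \<bar>u i l\<bar>))"
  define T where "T = (\<lambda>j. Matrix.vec r (v j)) ` {..<q} \<union> (\<lambda>l. \<eta> \<cdot>\<^sub>v unit_vec r l) ` {..<r}"
  define A where "A = (\<lambda>b::nat \<Rightarrow> real Matrix.vec. mat r r (\<lambda>(p, l). b l $ p))"
  have sum_pos: "1 + (\<Sum>i<m. \<Sum>l<r. \<bar>u i l\<bar>) > 0"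
    by (intro add_pos_nonneg sum_nonneg) auto
  have \<eta>: "\<eta> > 0" unfolding \<eta>_def using k sum_pos by simp
  have T: "finite T" "T \<subseteq> carrier_vec r" by (auto simp: T_def)
  have uT: "\<bar>\<Sum>p<r. u i p * x $ p\<bar> \<le> k" if i: "i < m" and x: "x \<in> T" for i x
    using x unfolding T_def
  proof
    assume "x \<in> (\<lambda>l. \<eta> \<cdot>\<^sub>v unit_vec r l) ` {..<r}"
    then obtain l where l: "l < r" "x = \<eta> \<cdot>\<^sub>v unit_vec r l" by auto
    have "(\<Sum>p<r. u i p * x $ p) = (\<Sum>p<r. if p = l then \<eta> * u i l else 0)"
      using l by (intro sum.cong) auto
    also have "\<dots> = \<eta> * u i l" using l by simp
    finally have eq: "(\<Sum>p<r. u i p * x $ p) = \<eta> * u i l" .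
    have "\<bar>u i l\<bar> \<le> (\<Sum>l<r. \<bar>u i l\<bar>)" using l by (intro member_le_sum) auto
    also have "\<dots> \<le> (\<Sum>i<m. \<Sum>l<r. \<bar>u i l\<bar>)"
      using i by (intro member_le_sum[of i "{..<m}" "\<lambda>i. \<Sum>l<r. \<bar>u i l\<bar>"]) (auto intro: sum_nonneg)
    finally have "\<eta> * \<bar>u i l\<bar> \<le> \<eta> * (1 + (\<Sum>i<m. \<Sum>l<r. \<bar>u i l\<bar>))"
      using \<eta> by (intro mult_left_mono) auto
    also have "\<dots> = k" using sum_pos by (simp add: \<eta>_def)
    finally show ?thesis using \<eta> by (simp add: eq abs_mult)
  qed (use uv i in auto)
  let ?P = "{..<r} \<rightarrow>\<^sub>E T"
  have finP: "finite ?P" using T by (intro finite_PiE) auto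
  define b0 where "b0 = (\<lambda>l\<in>{..<r}. \<eta> \<cdot>\<^sub>v unit_vec r l)"
  have b0: "b0 \<in> ?P" by (auto simp: b0_def T_def)
  have "A b0 = \<eta> \<cdot>\<^sub>m 1\<^sub>m r" by (auto simp: A_def b0_def intro!: eq_matI)
  then have det0: "det (A b0) \<noteq> 0" using \<eta> by simp
  obtain b where b: "b \<in> ?P" and max: "\<And>b'. b' \<in> ?P \<Longrightarrow> \<bar>det (A b')\<bar> \<le> \<bar>det (A b)\<bar>"
  proof -
    obtain b where "is_arg_min (\<lambda>b. - \<bar>det (A b)\<bar>) (\<lambda>b. b \<in> ?P) b"
      using ex_is_arg_min_if_finite[OF finP] b0 by blast
    then show ?thesis using that[of b] by (simp add: is_arg_min_linorder)
  qed
  have detA: "det (A b) \<noteq> 0" using max[OF b0] det0 by auto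
  have Ab: "A b \<in> carrier_mat r r" by (simp add: A_def)
  have "\<exists>x. x \<in> carrier_vec r \<and> A b *\<^sub>v x = y \<and> (\<forall>l<r. \<bar>x $ l\<bar> \<le> 1)" if y: "y \<in> T" for y
  proof -
    have yc: "y \<in> carrier_vec r" using y T by auto
    define B where "B = (1 / det (A b)) \<cdot>\<^sub>m adj_mat (A b)"
    have B: "B \<in> carrier_mat r r" "A b * B = 1\<^sub>m r"
      using adj_mat[OF Ab] Ab detA by (auto simp: B_def mult_smult_distrib)
    define x where "x = B *\<^sub>v y"
    have xc: "x \<in> carrier_vec r" using mult_mat_vec_carrier[OF B(1) yc] by (simp add: x_def)
    have Abx: "A b *\<^sub>v x = y"
      using assoc_mult_mat_vec[OF Ab B(1) yc] B yc by (simp add: x_def)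
    have "\<bar>x $ l\<bar> \<le> 1" if l: "l < r" for l
    proof -
      \<comment> \<open>Exchanging column \<open>l\<close> for \<open>y\<close> yields another tuple
        from \<open>T\<close>, so its determinant is controlled by maximality; Cramer's rule
        identifies it with \<open>x $ l * det (A b)\<close>.\<close>
      have "replace_col (A b) y l = A (b(l := y))"
        using l by (auto simp: replace_col_def A_def intro!: eq_matI)
      moreover have "b(l := y) \<in> ?P" using b y l by (auto simp: PiE_iff extensional_def)
      ultimately have "\<bar>x $ l * det (A b)\<bar> \<le> \<bar>det (A b)\<bar>"
        using cramer_lemma_mat[OF Ab xc l] max Abx by metis
      then show ?thesis using detA by (simp add: abs_mult)
    qed
    then show ?thesis using xc Abx by blast
  qed
  then obtain X where X: "\<And>y. y \<in> T \<Longrightarrow> X y \<in> carrier_vec r" "\<And>y. y \<in> T \<Longrightarrow> A b *\<^sub>v X y = y"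
      "\<And>y l. y \<in> T \<Longrightarrow> l < r \<Longrightarrow> \<bar>X y $ l\<bar> \<le> 1"
    by metis
  let ?y = "\<lambda>j. Matrix.vec r (v j)"
  show ?thesis
  proof (rule that[of "\<lambda>i l. \<Sum>p<r. u i p * b l $ p" "\<lambda>j l. X (?y j) $ l"])
    fix i j assume i: "i < m" and j: "j < q"
    then have yT: "?y j \<in> T" by (auto simp: T_def)
    have v: "v j p = (\<Sum>l<r. b l $ p * X (?y j) $ l)" if p: "p < r" for p
    proof -
      have "v j p = (A b *\<^sub>v X (?y j)) $ p" using p by (simp add: X(2)[OF yT])
      also have "\<dots> = (\<Sum>l<r. b l $ p * X (?y j) $ l)"
        using p X(1)[OF yT] by (simp add: A_def scalar_prod_def atLeast0LessThan)
      finally show ?thesis .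
    qed
    have "(\<Sum>p<r. u i p * v j p) = (\<Sum>p<r. \<Sum>l<r. u i p * b l $ p * X (?y j) $ l)"
      by (intro sum.cong refl) (simp add: v sum_distrib_left mult_ac)
    also have "\<dots> = (\<Sum>l<r. (\<Sum>p<r. u i p * b l $ p) * X (?y j) $ l)"
      by (subst sum.swap) (simp add: sum_distrib_right)
    finally show "(\<Sum>p<r. u i p * v j p) = (\<Sum>l<r. (\<Sum>p<r. u i p * b l $ p) * X (?y j) $ l)" .
  next
    fix i l assume "i < m" "l < r"
    then show "\<bar>\<Sum>p<r. u i p * b l $ p\<bar> \<le> k" using b by (intro uT) auto
  next
    fix j l assume "j < q" "l < r"
    then show "\<bar>X (?y j) $ l\<bar> \<le> 1" by (intro X) (auto simp: T_def)
  qed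
qed

text \<open>After bounded factorization, the rescaled factors \<open>L * c i l / k\<close> and
  \<open>L * w j l\<close> lie in \<open>[-L, L]\<close> and are rounded down to integers. The net
  consists of the products of all such integer factors, so its size is a count of pairs of integer
  matrices.\<close>

lemma low_rank_net:
  fixes k :: real and m q r :: nat
  assumes r: "1 \<le> r" "r \<le> q" and m: "m \<le> q" and q: "2 \<le> q" and k: "0 < k"
  obtains \<N> :: "(nat \<times> nat \<Rightarrow> real) set" where
    "finite \<N>" "card \<N> \<le> exp (10 * (real q * real r * ln q))"
    "\<And>u v :: nat \<Rightarrow> nat \<Rightarrow> real. \<forall>i<m. \<forall>j<q. \<bar>\<Sum>l<r. u i l * v j l\<bar> \<le> k \<Longrightarrow>
       \<exists>Z\<in>\<N>. \<forall>i<m. \<forall>j<q. \<bar>(\<Sum>l<r. u i l * v j l) - Z (i, j)\<bar> \<le> k / q"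
proof -
  \<comment> \<open>Each of the \<open>r\<close> summands of an entry will be off by at most
    \<open>k / L\<^sup>2 * (2 * L)\<close>, in total \<open>2 * r * k / L = k / q\<close>.\<close>
  define L where "L = 2 * r * q"
  have L: "L > 0" using r q by (simp add: L_def)
  define P where "P = (\<lambda>p::nat. ({..<p} \<times> {..<r}) \<rightarrow>\<^sub>E {- int L..int L})"
  define grid where "grid = (\<lambda>(a :: nat \<times> nat \<Rightarrow> int, b :: nat \<times> nat \<Rightarrow> int) (i, j).
    k / (real L)\<^sup>2 * (\<Sum>l<r. real_of_int (a (i, l)) * real_of_int (b (j, l))))"
  have finP: "finite (P p)" for p unfolding P_def by (intro finite_PiE) auto
  have cardP: "card (P p) = (2 * L + 1) ^ (p * r)" for p
  proof -
    have "card {- int L..int L} = 2 * L + 1" by (simp add: nat_eq_iff)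
    then show ?thesis unfolding P_def by (subst card_PiE) auto
  qed
  have "card (grid ` (P m \<times> P q)) \<le> card (P m) * card (P q)"
    using card_image_le[of "P m \<times> P q" grid] finP by (simp add: card_cartesian_product)
  also have "\<dots> = (2 * L + 1) ^ ((m + q) * r)"
    by (simp add: cardP power_add[symmetric] algebra_simps)
  also have "\<dots> \<le> (2 * L + 1) ^ (2 * q * r)"
    using m by (intro power_increasing) auto
  \<comment> \<open>From \<open>2 * L + 1 \<le> 5 * q\<^sup>2 \<le> 8 * q\<^sup>2 \<le> q ^
    5\<close>, using \<open>q \<ge> 2\<close>. The constant 10 of the cardinality bound is
    \<open>5 * 2\<close>.\<close>
  also have "\<dots> \<le> (q ^ 5) ^ (2 * q * r)"
  proof (rule power_mono)
    have "2 * L + 1 \<le> 4 * q * q + 1 * 1"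
      using r by (simp add: L_def)
    also have "\<dots> \<le> 4 * q * q + q * q"
      using q by (intro add_left_mono mult_le_mono) auto
    also have "\<dots> \<le> 2 ^ 3 * (q * q)" by simp
    also have "\<dots> \<le> q ^ 3 * (q * q)"
      using q by (intro mult_le_mono1 power_mono) auto
    finally show "2 * L + 1 \<le> q ^ 5" by (simp add: eval_nat_numeral)
  qed simp
  also have "\<dots> = q ^ (10 * q * r)" by (simp add: power_mult[symmetric] mult.assoc)
  finally have "real (card (grid ` (P m \<times> P q))) \<le> real q ^ (10 * q * r)"
    by (metis of_nat_le_iff of_nat_power)
  also have "\<dots> = exp (10 * (real q * real r * ln q))"
    using q by (simp add: powr_realpow[symmetric] powr_def mult_ac)
  finally have card: "card (grid ` (P m \<times> P q)) \<le> exp (10 * (real q * real r * ln q))" .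
  show ?thesis
  proof (rule that[OF _ card])
    show "finite (grid ` (P m \<times> P q))" using finP by simp
    fix u v :: "nat \<Rightarrow> nat \<Rightarrow> real"
    assume bounded: "\<forall>i<m. \<forall>j<q. \<bar>\<Sum>l<r. u i l * v j l\<bar> \<le> k"
    obtain c w where
      c: "\<And>i l. i < m \<Longrightarrow> l < r \<Longrightarrow> \<bar>c i l\<bar> \<le> k" and
      w: "\<And>j l. j < q \<Longrightarrow> l < r \<Longrightarrow> \<bar>w j l\<bar> \<le> 1" and
      uv: "\<And>i j. i < m \<Longrightarrow> j < q \<Longrightarrow> (\<Sum>l<r. u i l * v j l) = (\<Sum>l<r. c i l * w j l)"
      by (rule bounded_factorization[OF k bounded[rule_format]]) (assumption | rule that)+
    \<comment> \<open>Rounding down stays in range because the end points are integers.\<close>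
    have floor_bound: "- int L \<le> \<lfloor>x\<rfloor> \<and> \<lfloor>x\<rfloor> \<le> int L" if "\<bar>x\<bar> \<le> L" for x :: real
      using that by (auto simp: le_floor_iff floor_le_iff)
    have c': "\<bar>L * c i l / k\<bar> \<le> L" if "i < m" "l < r" for i l
      using c[OF that] k L by (simp add: abs_mult field_simps)
    have w': "\<bar>L * w j l\<bar> \<le> L" if "j < q" "l < r" for j l
      using w[OF that] L by (simp add: abs_mult)
    define a where "a = (\<lambda>(i, l) \<in> {..<m} \<times> {..<r}. \<lfloor>L * c i l / k\<rfloor>)"
    define b where "b = (\<lambda>(j, l) \<in> {..<q} \<times> {..<r}. \<lfloor>L * w j l\<rfloor>)"
    have "a \<in> P m" "b \<in> P q"
      using floor_bound c' w' by (auto simp: a_def b_def P_def)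
    then have "grid (a, b) \<in> grid ` (P m \<times> P q)" by blast
    moreover have "\<bar>(\<Sum>l<r. u i l * v j l) - grid (a, b) (i, j)\<bar> \<le> k / q" if i: "i < m" and j: "j < q" for i j
    proof -
      have prod_le: "\<bar>x * y - \<lfloor>x\<rfloor> * \<lfloor>y\<rfloor>\<bar> \<le> 2 * L" if "\<bar>x\<bar> \<le> L" "\<bar>y\<bar> \<le> L" for x y :: real
      proof -
        have fy: "\<bar>real_of_int \<lfloor>y\<rfloor>\<bar> \<le> L" using floor_bound[OF that(2)] by linarith
        have "x * y - \<lfloor>x\<rfloor> * \<lfloor>y\<rfloor> = x * (y - \<lfloor>y\<rfloor>) + (x - \<lfloor>x\<rfloor>) * \<lfloor>y\<rfloor>" by (simp add: algebra_simps)
        also have "\<bar>\<dots>\<bar> \<le> \<bar>x\<bar> * \<bar>y - \<lfloor>y\<rfloor>\<bar> + \<bar>x - \<lfloor>x\<rfloor>\<bar> * \<bar>real_of_int \<lfloor>y\<rfloor>\<bar>"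
          by (rule order_trans[OF abs_triangle_ineq]) (simp add: abs_mult)
        also have "\<dots> \<le> real L * 1 + 1 * real L"
          using that fy by (intro add_mono mult_mono) (linarith | simp)+
        finally show ?thesis by simp
      qed
      have "(\<Sum>l<r. u i l * v j l) - grid (a, b) (i, j)
        = (\<Sum>l<r. c i l * w j l - k / (real L)\<^sup>2 * (real_of_int (a (i, l)) * real_of_int (b (j, l))))"
        by (simp add: grid_def uv[OF i j] sum_subtractf sum_distrib_left)
      also have "\<bar>\<dots>\<bar> \<le> (\<Sum>l<r. k / (real L)\<^sup>2 * (2 * L))"
      proof (rule order_trans[OF sum_abs], rule sum_mono)
        fix l assume "l \<in> {..<r}"
        then have l: "l < r" by simp
        have "c i l * w j l - k / (real L)\<^sup>2 * (real_of_int (a (i, l)) * real_of_int (b (j, l)))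
          = k / (real L)\<^sup>2 * ((L * c i l / k) * (L * w j l) - \<lfloor>L * c i l / k\<rfloor> * \<lfloor>L * w j l\<rfloor>)"
          using i j l k L by (simp add: a_def b_def right_diff_distrib) (simp add: power2_eq_square)
        also have "\<bar>\<dots>\<bar> \<le> k / (real L)\<^sup>2 * (2 * L)"
          unfolding abs_mult using k
          by (intro mult_mono prod_le c' w' i j l) auto
        finally show "\<bar>c i l * w j l - k / (real L)\<^sup>2 * (real_of_int (a (i, l)) * real_of_int (b (j, l)))\<bar>
          \<le> k / (real L)\<^sup>2 * (2 * L)" .
      qed
      also have "\<dots> = k / q"
        using r q by (simp add: L_def power2_eq_square)
      finally show ?thesis .
    qed
    ultimately show "\<exists>Z\<in>grid ` (P m \<times> P q). \<forall>i<m. \<forall>j<q. \<bar>(\<Sum>l<r. u i l * v j l) - Z (i, j)\<bar> \<le> k / q"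
      by blast
  qed
qed

section \<open>Sampled versus full error, uniformly over low rank matrices\<close>

lemma L2_set_minus_commute: "L2_set (\<lambda>x. f x - g x) A = L2_set (\<lambda>x. g x - f x) A"
  by (simp add: L2_set_def power2_commute)

lemma L2_set_triangle_diff:
  "L2_set (\<lambda>x. f x - h x) A \<le> L2_set (\<lambda>x. f x - g x) A + L2_set (\<lambda>x. g x - h x) A"
  using L2_set_triangle_ineq[of "\<lambda>x. f x - g x" "\<lambda>x. g x - h x" A] by simp

lemma L2_set_le_const:
  assumes "\<And>x. x \<in> A \<Longrightarrow> \<bar>f x\<bar> \<le> c"
  shows "L2_set f A \<le> sqrt (card A) * c"
proof (cases "A = {}")
  case False
  then have c: "c \<ge> 0" using assms abs_ge_zero order_trans by blast
  have "(\<Sum>x\<in>A. (f x)\<^sup>2) \<le> card A * c\<^sup>2"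
    by (rule sum_bounded_above) (metis abs_ge_zero assms power2_abs power_mono)
  then have "L2_set f A \<le> sqrt (card A * c\<^sup>2)"
    unfolding L2_set_def by simp
  then show ?thesis using c by (simp add: real_sqrt_mult)
qed simp

text \<open>Union bound over the net: at most \<open>exp (10 * \<tau>)\<close> points, each failing
  with probability at most \<open>exp (- (12 * \<tau>))\<close>. A matrix is then exchanged for a
  nearby net point at cost \<open>k / q\<close> in both the full and the sampled root mean square.
  The fourth root arises because mean squares deviate by order \<open>sqrt (\<tau> / N)\<close> and
  a root is taken afterwards.\<close>

lemma uniform_low_rank_deviation:
  fixes k :: real and m q r N :: nat and M0 :: "nat \<times> nat \<Rightarrow> real"
  assumes r: "1 \<le> r" "r \<le> q" and m: "1 \<le> m" "m \<le> q" and q: "2 \<le> q" and k: "0 < k"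
    and N: "1 \<le> N" "N \<le> m * q"
    and M0: "\<And>i j. i < m \<Longrightarrow> j < q \<Longrightarrow> \<bar>M0 (i, j)\<bar> \<le> k"
  shows "1 - exp (- real q) \<le> measure_pmf.prob (pmf_of_set (sampling_sets m q N))
    {\<Omega> \<in> sampling_sets m q N. \<forall>u v. (\<forall>i<m. \<forall>j<q. \<bar>\<Sum>l<r. u i l * v j l\<bar> \<le> k) \<longrightarrow>
       L2_set (\<lambda>(i, j). (\<Sum>l<r. u i l * v j l) - M0 (i, j)) ({..<m} \<times> {..<q}) / sqrt (m * q)
       \<le> L2_set (\<lambda>(i, j). (\<Sum>l<r. u i l * v j l) - M0 (i, j)) \<Omega> / sqrt N
         + 9 * k * (real q * real r * ln q / N) powr (1 / 4)}"
    (is "_ \<le> measure_pmf.prob ?p ?good")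
proof -
  define S where "S = {..<m} \<times> {..<q}"
  define D where "D = m * q"
  define \<tau> where "\<tau> = real q * real r * ln q"
  \<comment> \<open>The factor 45 makes the Chernoff exponent
    \<open>2025 / 162 * \<tau> = 12.5 * \<tau>\<close>, enough to beat the net size, while
    \<open>sqrt 45 \<le> 7\<close>.\<close>
  define t where "t = 45 * k\<^sup>2 * sqrt (\<tau> / N)"
  have S: "finite S" "card S = D" by (auto simp: S_def D_def)
  have D: "D > 0" using m q by (simp add: D_def)
  have "ln 2 \<le> ln (real q)" using q by simp
  then have lnq: "ln (real q) \<ge> 1 / 2" using ln2_ge_two_thirds by linarith
  have "real q * 1 * (1 / 2) \<le> \<tau>"
    unfolding \<tau>_def using r lnq by (intro mult_mono) auto
  \<comment> \<open>This turns the surviving failure probability \<open>exp (- (2 * \<tau>))\<close>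
    into \<open>exp (- real q)\<close>.\<close>
  then have \<tau>: "q \<le> 2 * \<tau>" by simp
  then have \<tau>1: "1 \<le> \<tau>" using q by linarith
  have t: "t \<ge> 0" using \<tau>1 by (simp add: t_def)
  have t2: "t\<^sup>2 = 2025 * k ^ 4 * (\<tau> / N)"
    using \<tau>1 by (simp add: t_def power_mult_distrib)
  let ?F = "sampling_sets m q N"
  have F: "?F = {A. A \<subseteq> S \<and> card A = N}" by (simp add: sampling_sets_def S_def)
  have finF: "finite ?F" unfolding F using S by auto
  have "card ?F = D choose N" unfolding F using n_subsets S by metis
  moreover have "D choose N > 0" using N by (simp add: D_def zero_less_binomial)
  ultimately have neF: "?F \<noteq> {}" by (metis card.empty less_irrefl)
  obtain \<N> where \<N>: "finite \<N>" "card \<N> \<le> exp (10 * \<tau>)"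
    and net: "\<And>u v :: nat \<Rightarrow> nat \<Rightarrow> real. \<forall>i<m. \<forall>j<q. \<bar>\<Sum>l<r. u i l * v j l\<bar> \<le> k \<Longrightarrow>
       \<exists>Z\<in>\<N>. \<forall>i<m. \<forall>j<q. \<bar>(\<Sum>l<r. u i l * v j l) - Z (i, j)\<bar> \<le> k / q"
    by (rule low_rank_net[OF r m(2) q k, folded \<tau>_def]) (rule that; assumption)
  \<comment> \<open>Net points near an admissible matrix have entries at most
    \<open>k + k / q \<le> 2 * k\<close>. Restricting to such points bounds the squared errors by
    \<open>(3 * k)\<^sup>2\<close>, the range used in the Chernoff bound.\<close>
  define \<N>' where "\<N>' = {Z \<in> \<N>. \<forall>x\<in>S. \<bar>Z x\<bar> \<le> 2 * k}"
  define f where "f = (\<lambda>Z x. (Z x - M0 x)\<^sup>2)"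
  define bad where "bad = (\<lambda>Z. {A. sum (f Z) A \<le> N * (sum (f Z) S / card S - t)})"
  have fin': "finite \<N>'" using \<N> by (simp add: \<N>'_def)
  have bad1: "measure_pmf.prob ?p (bad Z) \<le> exp (- (12 * \<tau>))" if Z: "Z \<in> \<N>'" for Z
  proof -
    have "measure_pmf.prob ?p (bad Z) \<le> exp (- (N * t\<^sup>2 / (2 * (9 * k\<^sup>2)\<^sup>2)))"
      unfolding F bad_def
    proof (rule prob_sample_sum_le)
      fix x assume x: "x \<in> S"
      then have "\<bar>Z x\<bar> \<le> 2 * k" "\<bar>M0 x\<bar> \<le> k"
        using Z M0 by (auto simp: \<N>'_def S_def)
      then have "\<bar>Z x - M0 x\<bar> \<le> 3 * k" by linarith
      then have "\<bar>Z x - M0 x\<bar>\<^sup>2 \<le> (3 * k)\<^sup>2" by (intro power_mono) auto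
      then show "f Z x \<le> 9 * k\<^sup>2" by (simp add: f_def power_mult_distrib)
    qed (use S N t k in \<open>auto simp: D_def f_def\<close>)
    also have "N * t\<^sup>2 / (2 * (9 * k\<^sup>2)\<^sup>2) = 12.5 * \<tau>"
      unfolding t2 power_mult_distrib power_mult[symmetric] using N k by simp
    also have "exp (- (12.5 * \<tau>)) \<le> exp (- (12 * \<tau>))" using \<tau>1 by simp
    finally show ?thesis .
  qed
  have "measure_pmf.prob ?p (\<Union>Z\<in>\<N>'. bad Z) \<le> (\<Sum>Z\<in>\<N>'. measure_pmf.prob ?p (bad Z))"
    using fin' by (intro measure_UNION_le) auto
  also have "\<dots> \<le> card \<N>' * exp (- (12 * \<tau>))"
    using bad1 by (rule sum_bounded_above)
  also have "\<dots> \<le> exp (10 * \<tau>) * exp (- (12 * \<tau>))"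
  proof (intro mult_right_mono)
    have "card \<N>' \<le> card \<N>" using \<N> by (intro card_mono) (auto simp: \<N>'_def)
    then show "card \<N>' \<le> exp (10 * \<tau>)" using \<N> by linarith
  qed simp
  also have "\<dots> = exp (- (2 * \<tau>))" by (simp add: exp_add[symmetric])
  also have "\<dots> \<le> exp (- real q)" using \<tau> by simp
  finally have "1 - exp (- real q) \<le> 1 - measure_pmf.prob ?p (\<Union>Z\<in>\<N>'. bad Z)" by simp
  also have "\<dots> = measure_pmf.prob ?p (- (\<Union>Z\<in>\<N>'. bad Z))"
    using measure_pmf.prob_compl[of "\<Union>Z\<in>\<N>'. bad Z" ?p] by (simp add: Compl_eq_Diff_UNIV)
  \<comment> \<open>The uniform distribution is carried by \<open>?F\<close>, so membership in
    \<open>?F\<close>, part of \<open>?good\<close>, costs nothing.\<close>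
  also have "\<dots> = measure_pmf.prob ?p (- (\<Union>Z\<in>\<N>'. bad Z) \<inter> ?F)"
    using measure_Int_set_pmf[of ?p "- (\<Union>Z\<in>\<N>'. bad Z)"] finF neF by simp
  also have "\<dots> \<le> measure_pmf.prob ?p ?good"
  proof (rule measure_pmf.finite_measure_mono)
    show "- (\<Union>Z\<in>\<N>'. bad Z) \<inter> ?F \<subseteq> ?good"
    proof (intro subsetI CollectI conjI allI impI)
      fix \<Omega> and u v :: "nat \<Rightarrow> nat \<Rightarrow> real"
      assume \<Omega>: "\<Omega> \<in> - (\<Union>Z\<in>\<N>'. bad Z) \<inter> ?F"
      then show "\<Omega> \<in> ?F" by simp
      have \<Omega>S: "\<Omega> \<subseteq> S" "card \<Omega> = N" "finite \<Omega>" using \<Omega> S finite_subset by (auto simp: F)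
      assume uv: "\<forall>i<m. \<forall>j<q. \<bar>\<Sum>l<r. u i l * v j l\<bar> \<le> k"
      define X where "X = (\<lambda>(i, j). \<Sum>l<r. u i l * v j l)"
      obtain Z where Z: "Z \<in> \<N>" and XZ: "\<And>x. x \<in> S \<Longrightarrow> \<bar>X x - Z x\<bar> \<le> k / q"
        using net[of u v] uv by (auto simp: S_def X_def)
      have "k / q \<le> k" using k q by (simp add: field_simps)
      moreover have "\<bar>X x\<bar> \<le> k" if "x \<in> S" for x using uv that by (auto simp: X_def S_def)
      ultimately have "\<bar>Z x\<bar> \<le> 2 * k" if "x \<in> S" for x using XZ[OF that] that by fastforce
      then have Z': "Z \<in> \<N>'" using Z by (simp add: \<N>'_def)
      let ?d = "\<lambda>x. X x - M0 x" and ?z = "\<lambda>x. Z x - M0 x"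
      have "L2_set ?d S \<le> L2_set (\<lambda>x. X x - Z x) S + L2_set ?z S"
        by (rule L2_set_triangle_diff)
      also have "L2_set (\<lambda>x. X x - Z x) S \<le> sqrt D * (k / q)"
        using L2_set_le_const[of S "\<lambda>x. X x - Z x" "k / q"] XZ S by simp
      finally have 1: "L2_set ?d S / sqrt D \<le> k / q + L2_set ?z S / sqrt D"
        using D by (simp add: field_simps)
      have "L2_set ?z \<Omega> \<le> L2_set (\<lambda>x. Z x - X x) \<Omega> + L2_set ?d \<Omega>"
        by (rule L2_set_triangle_diff)
      also have "L2_set (\<lambda>x. Z x - X x) \<Omega> \<le> sqrt N * (k / q)"
        using L2_set_le_const[of \<Omega> "\<lambda>x. Z x - X x" "k / q"] XZ \<Omega>S
        by (auto simp: abs_minus_commute subset_iff)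
      finally have 2: "L2_set ?z \<Omega> / sqrt N \<le> k / q + L2_set ?d \<Omega> / sqrt N"
        using N by (simp add: field_simps)
      have sq: "(L2_set ?z A)\<^sup>2 = sum (f Z) A" for A
        by (simp add: L2_set_def f_def sum_nonneg)
      have "\<Omega> \<notin> bad Z" using \<Omega> Z' by blast
      then have "sum (f Z) S / D \<le> sum (f Z) \<Omega> / N + t"
        using N S by (simp add: bad_def field_simps)
      \<comment> \<open>Adding the nonnegative cross term completes the square, which allows taking
        roots.\<close>
      also have "\<dots> \<le> (L2_set ?z \<Omega> / sqrt N + sqrt t)\<^sup>2"
        using t by (simp add: power2_sum power_divide sq)
      finally have "(L2_set ?z S / sqrt D)\<^sup>2 \<le> (L2_set ?z \<Omega> / sqrt N + sqrt t)\<^sup>2"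
        by (simp add: power_divide sq)
      then have 3: "L2_set ?z S / sqrt D \<le> L2_set ?z \<Omega> / sqrt N + sqrt t"
        by (rule power2_le_imp_le) (use t in auto)
      let ?e = "(\<tau> / N) powr (1 / 4)"
      have e2: "?e\<^sup>2 = sqrt (\<tau> / N)" 
        using \<tau>1 N by (simp add: powr_half_sqrt[symmetric] powr_power)
      have "sqrt t \<le> 7 * k * ?e"
      proof (rule real_le_lsqrt)
        show "t \<le> (7 * k * ?e)\<^sup>2"
          unfolding power_mult_distrib e2 t_def using \<tau>1 by (intro mult_right_mono) auto
      qed (use t k in auto)
      \<comment> \<open>The net error is absorbed: \<open>N \<le> q\<^sup>2\<close> and
        \<open>\<tau> \<ge> 1\<close> give \<open>1 / q \<le> ?e\<^sup>2\<close>, and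
        \<open>(1 / q)\<^sup>2 \<le> 1 / q\<close> then gives \<open>1 / q \<le> ?e\<close>.\<close>
      moreover have "k / q \<le> k * ?e"
      proof -
        have "real N \<le> real (q * q)" using N m by (meson mult_le_mono1 of_nat_mono order.trans)
        then have "1 / (real q)\<^sup>2 \<le> 1 / N" using N q by (simp add: field_simps power2_eq_square)
        also have "\<dots> \<le> \<tau> / N" using \<tau>1 by (intro divide_right_mono) auto
        finally have "sqrt (1 / (real q)\<^sup>2) \<le> sqrt (\<tau> / N)" by (rule real_sqrt_le_mono)
        then have "1 / real q \<le> ?e\<^sup>2" by (simp add: e2 real_sqrt_divide)
        moreover have "(1 / real q)\<^sup>2 \<le> 1 / real q" using q by (simp add: power2_eq_square field_simps)
        ultimately have "(1 / real q)\<^sup>2 \<le> ?e\<^sup>2" by linarith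
        then have "1 / real q \<le> ?e" by (rule power2_le_imp_le) simp
        then have "k * (1 / real q) \<le> k * ?e" using k by (intro mult_left_mono) auto
        then show ?thesis by simp
      qed
      \<comment> \<open>The constant is \<open>9 = 7 + 1 + 1\<close>: the Chernoff deviation and two
        exchanges with the net point.\<close>
      ultimately have "L2_set ?d S / sqrt D \<le> L2_set ?d \<Omega> / sqrt N + 9 * k * ?e"
        using 1 2 3 by linarith
      moreover have "?d = (\<lambda>(i, j). (\<Sum>l<r. u i l * v j l) - M0 (i, j))"
        by (auto simp: X_def)
      ultimately show "L2_set (\<lambda>(i, j). (\<Sum>l<r. u i l * v j l) - M0 (i, j)) ({..<m} \<times> {..<q}) / sqrt (m * q)
       \<le> L2_set (\<lambda>(i, j). (\<Sum>l<r. u i l * v j l) - M0 (i, j)) \<Omega> / sqrt N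
         + 9 * k * (real q * real r * ln q / N) powr (1 / 4)"
        by (simp add: S_def D_def \<tau>_def)
    qed
  qed simp
  finally show ?thesis .
qed

section \<open>Factorization of the ground truth\<close>

text \<open>A maximal independent set of columns has as many elements as the rank, and by maximality
  it spans all columns; its members become the columns of \<open>U\<close>.\<close>

lemma col_space_basis_mat:
  assumes A: "A \<in> carrier_mat n nc"
  obtains U where "U \<in> carrier_mat n (vec_space.rank n A)"
    "\<And>x. x \<in> vec_space.col_space n A \<Longrightarrow> \<exists>c\<in>carrier_vec (vec_space.rank n A). x = U *\<^sub>v c"
proof -
  interpret vec_space "TYPE('a)" n .
  have cols: "set (cols A) \<subseteq> carrier_vec n" using A cols_dim by blast
  let ?P = "\<lambda>T. T \<subseteq> set (cols A) \<and> lin_indpt T"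
  obtain S where S: "finite S" "maximal S ?P"
    using maximal_exists_superset[of "set (cols A)" ?P "{}"] lindep_span
    by auto
  then have PS: "S \<subseteq> set (cols A)" "lin_indpt S" by (auto simp: maximal_def)
  have Sc: "S \<subseteq> carrier_vec n" using PS cols by blast
  have rank: "rank A = card S" using rank_card_indpt[OF A S(2)] .
  have "set (cols A) \<subseteq> span S"
  proof (rule ccontr)
    assume "\<not> set (cols A) \<subseteq> span S"
    then obtain s where s: "s \<in> set (cols A)" "s \<notin> span S" by blast
    then have "s \<notin> S" using span_mem[OF Sc] by blast
    then have "lin_indpt (S \<union> {s})"
      using lin_dep_iff_in_span[OF Sc PS(2)] s cols by blast
    then show False using S(2) PS s \<open>s \<notin> S\<close> unfolding maximal_def by blast
  qed
  then have span: "col_space A \<subseteq> span S"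
    unfolding col_space_def using span_is_submodule[of S] Sc by (intro span_is_subset) auto
  obtain bs where bs: "set bs = S" "distinct bs" using finite_distinct_list[OF S(1)] by blast
  have len: "length bs = rank A" using bs rank distinct_card by metis
  show ?thesis
  proof (rule that)
    show "mat_of_cols n bs \<in> carrier_mat n (rank A)"
      using mat_of_cols_carrier(1)[of n bs] by (simp only: len)
    fix x assume "x \<in> col_space A"
    then have "x \<in> span_list bs" using span span_list_as_span[of bs] bs Sc by auto
    then obtain c where "x = lincomb_list c bs" by (auto simp: span_list_def)
    also have "\<dots> = mat_of_cols n bs *\<^sub>v Matrix.vec (length bs) c"
      using bs Sc by (intro lincomb_list_as_mat_mult) auto
    finally show "\<exists>c\<in>carrier_vec (rank A). x = mat_of_cols n bs *\<^sub>v c"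
      using len by auto
  qed
qed

text \<open>Columns from the column space of \<open>Y\<close> do not raise the rank, so the
  coefficients with respect to one basis form \<open>V\<close>. This makes the ground truth a
  candidate in the optimization problem.\<close>

lemma append_cols_factorization:
  fixes Y :: "'a :: field mat"
  assumes Y: "Y \<in> carrier_mat m n"
    and E: "\<And>i. i < ne \<Longrightarrow> e i \<in> vec_space.col_space m Y"
  obtains U V where "U \<in> carrier_mat m (vec_space.rank m Y)"
    "V \<in> carrier_mat (n + ne) (vec_space.rank m Y)"
    "append_cols Y (mat_of_cols m (map e [0..<ne])) = U * V\<^sup>T"
proof -
  interpret vec_space "TYPE('a)" m .
  let ?r = "rank Y" and ?E = "mat_of_cols m (map e [0..<ne])"
  obtain U where U: "U \<in> carrier_mat m ?r"
    and UY: "\<And>x. x \<in> col_space Y \<Longrightarrow> \<exists>c\<in>carrier_vec ?r. x = U *\<^sub>v c"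
    using col_space_basis_mat[OF Y] by blast
  define x where "x = (\<lambda>j. if j < n then col Y j else e (j - n))"
  have "x j \<in> col_space Y" if "j < n + ne" for j
  proof (cases "j < n")
    case True
    then have "col Y j \<in> set (cols Y)" using Y by (auto simp: cols_def)
    moreover have "set (cols Y) \<subseteq> carrier_vec m" using Y cols_dim by blast
    ultimately show ?thesis using True span_mem by (auto simp: x_def col_space_def)
  qed (use that E in \<open>auto simp: x_def\<close>)
  then have "\<forall>j. j < n + ne \<longrightarrow> (\<exists>c\<in>carrier_vec ?r. x j = U *\<^sub>v c)" using UY by blast
  then obtain c where c: "\<And>j. j < n + ne \<Longrightarrow> c j \<in> carrier_vec ?r"
      "\<And>j. j < n + ne \<Longrightarrow> x j = U *\<^sub>v c j"
    by metis
  define V where "V = mat (n + ne) ?r (\<lambda>(j, l). c j $ l)"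
  have V: "V \<in> carrier_mat (n + ne) ?r" by (simp add: V_def)
  have "append_cols Y ?E = U * V\<^sup>T"
  proof (rule eq_matI)
    fix i j assume "i < dim_row (U * V\<^sup>T)" "j < dim_col (U * V\<^sup>T)"
    then have i: "i < m" and j: "j < n + ne" using U V by auto
    have "append_cols Y ?E $$ (i, j) = x j $ i"
      using i j Y by (auto simp: append_cols_def x_def mat_of_cols_index)
    also have "\<dots> = (U * V\<^sup>T) $$ (i, j)"
      using i j U V c(1)[OF j] c(2)[OF j] by (auto simp: V_def scalar_prod_def intro!: sum.cong)
    finally show "append_cols Y ?E $$ (i, j) = (U * V\<^sup>T) $$ (i, j)" .
  qed (use U V Y in \<open>auto simp: append_cols_def\<close>)
  then show ?thesis using that U V by blast
qed

section \<open>Sampled error of an optimal solution\<close>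

lemma frob_norm_eq_L2_set:
  "frob_norm A = L2_set (\<lambda>x. A $$ x) ({..<dim_row A} \<times> {..<dim_col A})"
  by (simp add: frob_norm_def L2_set_def sum.cartesian_product)

lemma frob_norm_sampling_op:
  assumes "\<Omega> \<subseteq> {..<dim_row A} \<times> {..<dim_col A}"
  shows "frob_norm (sampling_op \<Omega> A) = L2_set (\<lambda>x. A $$ x) \<Omega>"
proof -
  let ?S = "{..<dim_row A} \<times> {..<dim_col A}"
  have "(\<Sum>x\<in>?S. (sampling_op \<Omega> A $$ x)\<^sup>2) = (\<Sum>x\<in>?S. if x \<in> \<Omega> then (A $$ x)\<^sup>2 else 0)"
    by (intro sum.cong) (auto simp: sampling_op_def)
  also have "\<dots> = (\<Sum>x\<in>?S \<inter> \<Omega>. (A $$ x)\<^sup>2)" by (simp add: sum.inter_restrict)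
  also have "?S \<inter> \<Omega> = \<Omega>" using assms by blast
  finally show ?thesis
    by (simp add: frob_norm_eq_L2_set L2_set_def) (simp add: sampling_op_def)
qed

text \<open>At most \<open>smax\<close> nonzero entries in each of the last \<open>ne\<close>
  columns leave at most \<open>smax * ne\<close> nonzero summands, each at most
  \<open>c\<^sup>2\<close>.\<close>

lemma L2_set_sparse_columns_le:
  fixes f :: "nat \<times> nat \<Rightarrow> real"
  assumes \<Omega>: "\<Omega> \<subseteq> {..<m} \<times> {..<n + ne}"
    and f0: "\<And>i j. i < m \<Longrightarrow> j < n \<Longrightarrow> f (i, j) = 0"
    and sparse: "\<And>j. j < ne \<Longrightarrow> card {i. i < m \<and> f (i, n + j) \<noteq> 0} \<le> smax"
    and f: "\<And>x. x \<in> \<Omega> \<Longrightarrow> \<bar>f x\<bar> \<le> c" and c: "0 \<le> c"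
  shows "L2_set f \<Omega> \<le> c * sqrt (smax * ne)"
proof -
  define B where "B = (\<Union>j<ne. (\<lambda>i. (i, n + j)) ` {i. i < m \<and> f (i, n + j) \<noteq> 0})"
  have fin: "finite \<Omega>" using \<Omega> by (rule finite_subset) auto
  have finB: "finite B" by (auto simp: B_def)
  have "card B \<le> (\<Sum>j<ne. card ((\<lambda>i. (i, n + j)) ` {i. i < m \<and> f (i, n + j) \<noteq> 0}))"
    unfolding B_def by (rule card_UN_le) simp
  also have "\<dots> \<le> (\<Sum>j<ne. smax)"
    using sparse by (intro sum_mono) (auto intro: order_trans[OF card_image_le])
  finally have cardB: "card B \<le> smax * ne" by (simp add: mult.commute)
  have sub: "{x \<in> \<Omega>. f x \<noteq> 0} \<subseteq> B"
  proof
    fix x assume x: "x \<in> {x \<in> \<Omega>. f x \<noteq> 0}"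
    obtain i j where ij: "x = (i, j)" by fastforce
    have "i < m" "j < n + ne" "\<not> j < n" using x \<Omega> f0 ij by auto
    then show "x \<in> B" using x ij by (auto simp: B_def intro!: bexI[of _ "j - n"])
  qed
  have "(\<Sum>x\<in>\<Omega>. (f x)\<^sup>2) = (\<Sum>x\<in>{x \<in> \<Omega>. f x \<noteq> 0}. (f x)\<^sup>2)"
    using fin by (intro sum.mono_neutral_right) auto
  also have "\<dots> \<le> card {x \<in> \<Omega>. f x \<noteq> 0} * c\<^sup>2"
    using f by (intro sum_bounded_above) (auto intro: abs_le_square_iff[THEN iffD1] simp: abs_of_nonneg[OF c])
  also have "\<dots> \<le> (smax * ne) * c\<^sup>2"
    using order_trans[OF card_mono[OF finB sub] cardB] by (intro mult_right_mono) (simp_all flip: of_nat_mult)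
  finally have "L2_set f \<Omega> \<le> sqrt ((smax * ne) * c\<^sup>2)" by (simp add: L2_set_def)
  then show ?thesis using c by (simp add: real_sqrt_mult mult.commute)
qed

text \<open>Triangle inequality through the corrupted matrix: optimality bounds the first leg by the
  second, and the second is the sampled corruption. Its entries are differences of two numbers in
  \<open>[-k, k]\<close>, so the factor 4 is \<open>2 * 2\<close>.\<close>

lemma mf_solution_error_le:
  fixes k :: real
  assumes r: "vec_space.rank m Y = r" and k: "0 < k"
    and Y: "Y \<in> carrier_mat m n"
    and attack: "targeted_attack m Y ne smax egnd s"
    and e: "\<forall>i<ne. e i = egnd i + s i"
    and Egnd: "Egnd = mat_of_cols m (map egnd [0..<ne])"
    and Ehat: "Ehat = mat_of_cols m (map e [0..<ne])"
    and bd: "entries_bounded k (append_cols Y Egnd)"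
    and bd': "entries_bounded k (append_cols Y Ehat)"
    and \<Omega>: "\<Omega> \<subseteq> {..<m} \<times> {..<n + ne}"
    and sol: "mf_solution m (n + ne) r k \<Omega> (append_cols Y Ehat) U V"
  shows "L2_set (\<lambda>x. (U * V\<^sup>T) $$ x - append_cols Y Egnd $$ x) \<Omega> \<le> 4 * k * sqrt (smax * ne)"
proof -
  let ?G = "append_cols Y Egnd" and ?M = "append_cols Y Ehat"
  let ?S = "{..<m} \<times> {..<n + ne}"
  have egnd: "egnd i \<in> vec_space.col_space m Y" "s i \<in> carrier_vec m"
      "card {l. l < m \<and> s i $ l \<noteq> 0} \<le> smax" if "i < ne" for i
    using attack that by (auto simp: targeted_attack_def)
  have M0: "?G \<in> carrier_mat m (n + ne)" and M: "?M \<in> carrier_mat m (n + ne)"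
    using Y by (auto simp: append_cols_def Egnd Ehat)
  have objective: "mf_objective \<Omega> ?M (U, V) = 1 / 2 * (L2_set (\<lambda>x. (U * V\<^sup>T) $$ x - ?M $$ x) \<Omega>)\<^sup>2"
    if UV: "U \<in> carrier_mat m r" "V \<in> carrier_mat (n + ne) r" for U V
  proof -
    have "frob_norm (sampling_op \<Omega> (U * V\<^sup>T - ?M)) = L2_set (\<lambda>x. (U * V\<^sup>T - ?M) $$ x) \<Omega>"
      using \<Omega> M by (intro frob_norm_sampling_op) auto
    also have "\<dots> = L2_set (\<lambda>x. (U * V\<^sup>T) $$ x - ?M $$ x) \<Omega>"
      using \<Omega> M UV by (intro L2_set_cong) auto
    finally show ?thesis by (simp add: mf_objective_def)
  qed
  obtain U0 V0 where UV0: "U0 \<in> carrier_mat m r" "V0 \<in> carrier_mat (n + ne) r"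
      "?G = U0 * V0\<^sup>T"
    by (rule append_cols_factorization[where e = egnd and ne = ne, OF Y egnd(1), unfolded r, folded Egnd])
      (assumption | rule that)+
  have "mf_feasible m (n + ne) r k (U0, V0)"
    using UV0 bd by (simp add: mf_feasible_def)
  then have "mf_objective \<Omega> ?M (U, V) \<le> mf_objective \<Omega> ?M (U0, V0)"
    using sol by (auto simp: mf_solution_def is_arg_min_linorder)
  moreover have UV: "U \<in> carrier_mat m r" "V \<in> carrier_mat (n + ne) r"
    using sol by (auto simp: mf_solution_def is_arg_min_def mf_feasible_def)
  ultimately have "(L2_set (\<lambda>x. (U * V\<^sup>T) $$ x - ?M $$ x) \<Omega>)\<^sup>2 \<le> (L2_set (\<lambda>x. ?G $$ x - ?M $$ x) \<Omega>)\<^sup>2"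
    using UV0 by (simp add: objective)
  then have opt: "L2_set (\<lambda>x. (U * V\<^sup>T) $$ x - ?M $$ x) \<Omega> \<le> L2_set (\<lambda>x. ?G $$ x - ?M $$ x) \<Omega>"
    by (rule power2_le_imp_le) simp
  have "L2_set (\<lambda>x. ?M $$ x - ?G $$ x) \<Omega> \<le> (2 * k) * sqrt (smax * ne)"
  proof (rule L2_set_sparse_columns_le[OF \<Omega>])
    fix i j assume "i < m" "j < n"
    then show "?M $$ (i, j) - ?G $$ (i, j) = 0" using Y by (simp add: append_cols_def Egnd Ehat)
  next
    fix j assume j: "j < ne"
    have "?M $$ (i, n + j) - ?G $$ (i, n + j) = s j $ i" if "i < m" for i
      using that j Y e egnd(2)[OF j] by (simp add: append_cols_def Egnd Ehat mat_of_cols_index)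
    \<comment> \<open>In a dummy column the difference is exactly \<open>s j\<close>, whose support
      is controlled by the attack model.\<close>
    then have "{i. i < m \<and> ?M $$ (i, n + j) - ?G $$ (i, n + j) \<noteq> 0} = {i. i < m \<and> s j $ i \<noteq> 0}"
      by (intro Collect_cong conj_cong) simp_all
    then show "card {i. i < m \<and> ?M $$ (i, n + j) - ?G $$ (i, n + j) \<noteq> 0} \<le> smax"
      using egnd(3)[OF j] by simp
  next
    fix x assume "x \<in> \<Omega>"
    then obtain i j where "x = (i, j)" "i < m" "j < n + ne" using \<Omega> by auto
    then have "\<bar>?M $$ x\<bar> \<le> k" "\<bar>?G $$ x\<bar> \<le> k"
      using bd bd' M M0 by (auto simp: entries_bounded_def)
    then show "\<bar>?M $$ x - ?G $$ x\<bar> \<le> 2 * k" by linarith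
  qed (use k in simp)
  then show ?thesis
    using L2_set_triangle_diff[of "\<lambda>x. (U * V\<^sup>T) $$ x" "\<lambda>x. ?G $$ x" \<Omega> "\<lambda>x. ?M $$ x"] opt
      L2_set_minus_commute[of "\<lambda>x. ?G $$ x" "\<lambda>x. ?M $$ x" \<Omega>] by simp
qed

section \<open>Combining both bounds into the RMSE estimate\<close>

lemma rmse_eq_L2_set:
  assumes "Y \<in> carrier_mat m n" "Ystar \<in> carrier_mat m n"
    "E \<in> carrier_mat m ne" "Estar \<in> carrier_mat m ne"
  shows "rmse Ystar Estar Y E =
    L2_set (\<lambda>x. append_cols Ystar Estar $$ x - append_cols Y E $$ x) ({..<m} \<times> {..<n + ne})
      / sqrt (m * (n + ne))"
proof -
  have "frob_norm (append_cols (Ystar - Y) (Estar - E)) =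
    L2_set (\<lambda>x. append_cols Ystar Estar $$ x - append_cols Y E $$ x) ({..<m} \<times> {..<n + ne})"
    unfolding frob_norm_eq_L2_set using assms
    by (intro L2_set_cong) (auto simp: append_cols_def)
  then show ?thesis using assms by (simp add: rmse_def)
qed

theorem proposition3:
  shows "\<exists>C::real. C > 0 \<and>
    (\<forall>(r::nat) (m::nat) (n::nat) (ne::nat) (smax::nat) (N::nat) (k::real)
       (Y::real mat) (e::nat \<Rightarrow> real Matrix.vec) (egnd::nat \<Rightarrow> real Matrix.vec)
       (s::nat \<Rightarrow> real Matrix.vec) (Egnd::real mat) (Ehat::real mat).
      1 \<le> r \<and> r \<le> m \<and> m \<le> n \<and> 1 \<le> ne \<and> 0 < k \<and>
      Y \<in> carrier_mat m n \<and> vec_space.rank m Y = r \<and>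
      targeted_attack m Y ne smax egnd s \<and>
      (\<forall>i<ne. e i = egnd i + s i) \<and>
      Egnd = mat_of_cols m (map egnd [0..<ne]) \<and>
      Ehat = mat_of_cols m (map e [0..<ne]) \<and>
      entries_bounded k (append_cols Y Egnd) \<and>
      entries_bounded k (append_cols Y Ehat) \<and>
      1 \<le> N \<and> N \<le> m * (n + ne)
      \<longrightarrow>
      measure_pmf.prob (pmf_of_set (sampling_sets m (n + ne) N))
        {\<Omega>. \<forall>U V Ystar Estar.
           mf_solution m (n + ne) r k \<Omega> (append_cols Y Ehat) U V \<and>
           Ystar \<in> carrier_mat m n \<and> Estar \<in> carrier_mat m ne \<and>
           append_cols Ystar Estar = U * V\<^sup>T
           \<longrightarrow>
           rmse Ystar Estar Y Egnd
             \<le> 4 * k * sqrt (real (smax * ne) / real N)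
               + C * k * (real (n + ne) * real r * ln (real (n + ne)) / real N) powr (1 / 4)}
      \<ge> 1 - 2 * exp (- real (n + ne)))"
proof (intro exI[of _ 9] conjI allI impI, goal_cases)
  \<comment> \<open>The constant 9 comes from \<open>uniform_low_rank_deviation\<close>; its
    positivity is the first goal, left to the closing \<open>simp\<close>.\<close>
  case (2 r m n ne smax N k Y e egnd s Egnd Ehat)
  then have r: "1 \<le> r" "r \<le> m" "m \<le> n" and ne: "1 \<le> ne" and k: "0 < k"
    and Y: "Y \<in> carrier_mat m n" and rank: "vec_space.rank m Y = r"
    and attack: "targeted_attack m Y ne smax egnd s"
    and e: "\<forall>i<ne. e i = egnd i + s i"
    and Egnd: "Egnd = mat_of_cols m (map egnd [0..<ne])"
    and Ehat: "Ehat = mat_of_cols m (map e [0..<ne])"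
    and bd: "entries_bounded k (append_cols Y Egnd)"
    and bd': "entries_bounded k (append_cols Y Ehat)"
    and N: "1 \<le> N" "N \<le> m * (n + ne)"
    by auto
  define q where "q = n + ne"
  let ?G = "append_cols Y Egnd"
  let ?\<delta> = "9 * k * (real q * real r * ln (real q) / real N) powr (1 / 4)"
  let ?err = "\<lambda>u v (i, j). (\<Sum>l<r. u i l * v j l) - ?G $$ (i, j)"
  let ?good = "{\<Omega> \<in> sampling_sets m q N. \<forall>u v. (\<forall>i<m. \<forall>j<q. \<bar>\<Sum>l<r. u i l * v j l\<bar> \<le> k) \<longrightarrow>
       L2_set (?err u v) ({..<m} \<times> {..<q}) / sqrt (m * q) \<le> L2_set (?err u v) \<Omega> / sqrt N + ?\<delta>}"
  have E: "Egnd \<in> carrier_mat m ne" by (auto simp: Egnd)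
  have M0: "?G \<in> carrier_mat m q" using Y E by (auto simp: append_cols_def q_def)
  have "1 - 2 * exp (- real q) \<le> 1 - exp (- real q)" by simp
  also have "\<dots> \<le> measure_pmf.prob (pmf_of_set (sampling_sets m q N)) ?good"
    using r ne k N bd M0 by (intro uniform_low_rank_deviation) (auto simp: q_def entries_bounded_def)
  also have "\<dots> \<le> measure_pmf.prob (pmf_of_set (sampling_sets m q N))
        {\<Omega>. \<forall>U V Ystar Estar.
           mf_solution m q r k \<Omega> (append_cols Y Ehat) U V \<and>
           Ystar \<in> carrier_mat m n \<and> Estar \<in> carrier_mat m ne \<and>
           append_cols Ystar Estar = U * V\<^sup>T
           \<longrightarrow> rmse Ystar Estar Y Egnd \<le> 4 * k * sqrt (real (smax * ne) / real N) + ?\<delta>}"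
  proof (rule measure_pmf.finite_measure_mono)
    show "?good \<subseteq> {\<Omega>. \<forall>U V Ystar Estar.
           mf_solution m q r k \<Omega> (append_cols Y Ehat) U V \<and>
           Ystar \<in> carrier_mat m n \<and> Estar \<in> carrier_mat m ne \<and>
           append_cols Ystar Estar = U * V\<^sup>T
           \<longrightarrow> rmse Ystar Estar Y Egnd \<le> 4 * k * sqrt (real (smax * ne) / real N) + ?\<delta>}"
    proof (intro subsetI CollectI allI impI, elim conjE)
      fix \<Omega> U V Ystar Estar
      assume \<Omega>: "\<Omega> \<in> ?good"
        and sol: "mf_solution m q r k \<Omega> (append_cols Y Ehat) U V"
        and star: "Ystar \<in> carrier_mat m n" "Estar \<in> carrier_mat m ne"
        and X: "append_cols Ystar Estar = U * V\<^sup>T"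
      let ?u = "\<lambda>i l. U $$ (i, l)" and ?v = "\<lambda>j l. V $$ (j, l)"
      let ?d = "\<lambda>x. (U * V\<^sup>T) $$ x - ?G $$ x"
      have \<Omega>S: "\<Omega> \<subseteq> {..<m} \<times> {..<q}" using \<Omega> by (simp add: sampling_sets_def)
      have UV: "U \<in> carrier_mat m r" "V \<in> carrier_mat q r" "entries_bounded k (U * V\<^sup>T)"
        using sol by (auto simp: mf_solution_def is_arg_min_def mf_feasible_def)
      have entry: "(U * V\<^sup>T) $$ (i, j) = (\<Sum>l<r. ?u i l * ?v j l)" if "i < m" "j < q" for i j
        using that UV by (auto simp: scalar_prod_def atLeast0LessThan intro!: sum.cong)
      have "\<forall>i<m. \<forall>j<q. \<bar>\<Sum>l<r. ?u i l * ?v j l\<bar> \<le> k"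
        using UV by (auto simp: entries_bounded_def simp flip: entry)
      \<comment> \<open>The solution depends on \<open>\<Omega>\<close>. It may be inserted because
        \<open>?good\<close> demands the bound for all admissible factors simultaneously.\<close>
      with conjunct2[OF \<Omega>[unfolded mem_Collect_eq], THEN spec, THEN spec, THEN mp, of ?u ?v]
      have "L2_set (?err ?u ?v) ({..<m} \<times> {..<q}) / sqrt (m * q)
          \<le> L2_set (?err ?u ?v) \<Omega> / sqrt N + ?\<delta>" .
      moreover have "L2_set (?err ?u ?v) A = L2_set ?d A" if "A \<subseteq> {..<m} \<times> {..<q}" for A
        using that by (intro L2_set_cong) (auto simp: entry)
      ultimately have "L2_set ?d ({..<m} \<times> {..<q}) / sqrt (m * q) \<le> L2_set ?d \<Omega> / sqrt N + ?\<delta>"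
        using \<Omega>S by simp
      moreover have "rmse Ystar Estar Y Egnd = L2_set ?d ({..<m} \<times> {..<q}) / sqrt (m * q)"
        using rmse_eq_L2_set[OF Y star(1) E star(2)] X by (simp add: q_def)
      moreover have "L2_set ?d \<Omega> / sqrt N \<le> 4 * k * sqrt (smax * ne) / sqrt N"
        using mf_solution_error_le[OF rank k Y attack e Egnd Ehat bd bd' \<Omega>S[unfolded q_def] sol[unfolded q_def]]
        by (intro divide_right_mono) auto
      ultimately show "rmse Ystar Estar Y Egnd \<le> 4 * k * sqrt (real (smax * ne) / real N) + ?\<delta>"
        by (simp add: real_sqrt_divide)
    qed
  qed simp
  finally show ?case by (simp add: q_def)
qed simp

end
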